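(* Let $a>c$, let $\mathbf V'\subset\mathbf V$ be nonempty, and let $g:\mathbf V'\to\mathbb R$ satisfy $g(x)-g(y)\le S_a(y,x)$ for all $x,y\in\mathbf V'$. Then the function $$v(x)=\begin{cases}g(x), & x\in\mathbf V',\\ \min\{g(y)+S_a(y,x):y\in\mathbf V'\}, & x\notin\mathbf V',\end{cases}$$ is the unique function on $\mathbf V$ that solves $(DFE_a)$ at every $x\in\mathbf V\setminus\mathbf V'$ and agrees with $g$ on $\mathbf V'$; moreover $v$ is a subsolution of $(DFE_a)$ on all of $\mathbf V$.
   Context: Network $\Gamma$ (finite arcs $\mathcal E$ closed under inversion, vertices $\mathbf V$, connected), Hamiltonians $H_\gamma$ continuous, coercive, quasiconvex with $\mathrm{Int}\{H_\gamma(s,\cdot)\le b\}=\{H_\gamma(s,\cdot)<b\}$, $H_{\tilde\gamma}(s,p)=H_\gamma(1-s,-p)$; $a_0$ = max of $\max_s\min_pH_\gamma$ over non-closed arcs and of $c_\gamma$ (least level admitting a periodic viscosity subsolution) over closed arcs, with $\min_pH_\gamma(s,p)$ constant in $s$ whenever $\max_s\min_pH_\gamma=a_0$. Graph $\mathbf X=(\mathbf V,\mathbf E)$, bijection $\Psi:\mathbf E\to\mathcal E$, $\mathrm o(e)=\Psi(e)(0)$, $\mathrm t(e)=\Psi(e)(1)$, $-e=\Psi^{-1}(\widetilde{\Psi(e)})$, $\mathbf E_x=\{e:\mathrm o(e)=x\}$, $\sigma_a(e)=\int_0^1\max\{p:H_{\Psi(e)}(t,p)=a\}dt$. Paths $\xi=(e_1,\dots,e_M)$,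 $M\ge1$, $\mathrm t(e_j)=\mathrm o(e_{j+1})$; $\sigma_a(\xi)=\sum\sigma_a(e_i)$; $S_a(x,y)=\inf\{\sigma_a(\xi):\xi$ path from $x$ to $y\}$. $(DFE_a)$ at $x$: $u(x)=\min_{e\in\mathbf E_x}(u(\mathrm t(e))+\sigma_a(-e))$; subsolution: $u(\mathrm t(e))-u(\mathrm o(e))\le\sigma_a(e)$ $\forall e$. $c=\min\{a\ge a_0:(DFE_a)$ has a subsolution$\}$. *)

theory Defs
  imports "HOL-Analysis.Analysis"
begin

text \<open>The network is represented by its combinatorial graph:
  vertices V, arcs E (one graph edge per arc of the network), origin map src,
  terminal map tgt, arc inversion inv_e, and the Hamiltonian H e attached to the arc
  Psi(e), as a function of (s,p) in [0,1] x R.\<close>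

definition graph_ok ::
  "'v set \<Rightarrow> 'e set \<Rightarrow> ('e \<Rightarrow> 'v) \<Rightarrow> ('e \<Rightarrow> 'v) \<Rightarrow> ('e \<Rightarrow> 'e) \<Rightarrow> bool" where
  "graph_ok V E src tgt inv_e \<longleftrightarrow>
     finite E \<and> E \<noteq> {} \<and> V = src ` E \<and>
     (\<forall>e\<in>E. tgt e \<in> V \<and> inv_e e \<in> E \<and> inv_e e \<noteq> e \<and> inv_e (inv_e e) = e \<and>
              src (inv_e e) = tgt e \<and> tgt (inv_e e) = src e)"

definition is_path ::
  "'e set \<Rightarrow> ('e \<Rightarrow> 'v) \<Rightarrow> ('e \<Rightarrow> 'v) \<Rightarrow> 'e list \<Rightarrow> bool" where
  "is_path E src tgt xi \<longleftrightarrow> xi \<noteq> [] \<and> set xi \<subseteq> E \<and>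
     (\<forall>j. Suc j < length xi \<longrightarrow> tgt (xi ! j) = src (xi ! Suc j))"

definition path_from_to ::
  "'e set \<Rightarrow> ('e \<Rightarrow> 'v) \<Rightarrow> ('e \<Rightarrow> 'v) \<Rightarrow> 'v \<Rightarrow> 'v \<Rightarrow> 'e list \<Rightarrow> bool" where
  "path_from_to E src tgt x y xi \<longleftrightarrow>
     is_path E src tgt xi \<and> src (hd xi) = x \<and> tgt (last xi) = y"

definition connected_graph ::
  "'v set \<Rightarrow> 'e set \<Rightarrow> ('e \<Rightarrow> 'v) \<Rightarrow> ('e \<Rightarrow> 'v) \<Rightarrow> bool" where
  "connected_graph V E src tgt \<longleftrightarrow>
     (\<forall>x\<in>V. \<forall>y\<in>V. x \<noteq> y \<longrightarrow> (\<exists>xi. path_from_to E src tgt x y xi))"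

definition hamiltonian_ok :: "(real \<Rightarrow> real \<Rightarrow> real) \<Rightarrow> bool" where
  "hamiltonian_ok h \<longleftrightarrow>
     continuous_on ({0..1} \<times> UNIV) (\<lambda>(s,p). h s p) \<and>
     (\<forall>M. \<exists>R. \<forall>s\<in>{0..1}. \<forall>p. \<bar>p\<bar> \<ge> R \<longrightarrow> h s p \<ge> M) \<and>
     (\<forall>s\<in>{0..1}. \<forall>b. convex {p. h s p \<le> b}) \<and>
     (\<forall>s\<in>{0..1}. \<forall>b. interior {p. h s p \<le> b} = {p. h s p < b})"

definition minH :: "(real \<Rightarrow> real \<Rightarrow> real) \<Rightarrow> real \<Rightarrow> real" where
  "minH h s = Inf (range (h s))"

definition maxminH :: "(real \<Rightarrow> real \<Rightarrow> real) \<Rightarrow> real" where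
  "maxminH h = Sup (minH h ` {0..1})"

definition visc_subsol :: "(real \<Rightarrow> real \<Rightarrow> real) \<Rightarrow> real \<Rightarrow> (real \<Rightarrow> real) \<Rightarrow> bool" where
  "visc_subsol F b u \<longleftrightarrow> continuous_on UNIV u \<and>
     (\<forall>s d \<phi>. (\<phi> has_real_derivative d) (at s) \<and>
        (\<exists>\<delta>>0. \<forall>r. \<bar>r - s\<bar> < \<delta> \<longrightarrow> u r - \<phi> r \<le> u s - \<phi> s) \<longrightarrow> F s d \<le> b)"

text \<open>Periodic viscosity subsolution for a closed arc: 1-periodic u on R, subsolution
  of the equation with the Hamiltonian extended 1-periodically in s.\<close>
definition periodic_subsol :: "(real \<Rightarrow> real \<Rightarrow> real) \<Rightarrow> real \<Rightarrow> (real \<Rightarrow> real) \<Rightarrow> bool" where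
  "periodic_subsol h b u \<longleftrightarrow> (\<forall>s. u (s + 1) = u s) \<and>
     visc_subsol (\<lambda>s p. h (frac s) p) b u"

definition c_arc :: "(real \<Rightarrow> real \<Rightarrow> real) \<Rightarrow> real" where
  "c_arc h = Inf {b. \<exists>u. periodic_subsol h b u}"

definition a0 :: "'e set \<Rightarrow> ('e \<Rightarrow> 'v) \<Rightarrow> ('e \<Rightarrow> 'v) \<Rightarrow> ('e \<Rightarrow> real \<Rightarrow> real \<Rightarrow> real) \<Rightarrow> real" where
  "a0 E src tgt H = Max ((\<lambda>e. maxminH (H e)) ` {e\<in>E. src e \<noteq> tgt e} \<union>
                         (\<lambda>e. c_arc (H e)) ` {e\<in>E. src e = tgt e})"

definition network_ok ::
  "'v set \<Rightarrow> 'e set \<Rightarrow> ('e \<Rightarrow> 'v) \<Rightarrow> ('e \<Rightarrow> 'v) \<Rightarrow> ('e \<Rightarrow> 'e) \<Rightarrow>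
   ('e \<Rightarrow> real \<Rightarrow> real \<Rightarrow> real) \<Rightarrow> bool" where
  "network_ok V E src tgt inv_e H \<longleftrightarrow>
     graph_ok V E src tgt inv_e \<and> connected_graph V E src tgt \<and>
     (\<forall>e\<in>E. hamiltonian_ok (H e)) \<and>
     (\<forall>e\<in>E. \<forall>s\<in>{0..1}. \<forall>p. H (inv_e e) s p = H e (1 - s) (- p)) \<and>
     (\<forall>e\<in>E. maxminH (H e) = a0 E src tgt H \<longrightarrow>
        (\<forall>s\<in>{0..1}. minH (H e) s = a0 E src tgt H))"

definition sigma :: "('e \<Rightarrow> real \<Rightarrow> real \<Rightarrow> real) \<Rightarrow> real \<Rightarrow> 'e \<Rightarrow> real" where
  "sigma H a e = integral {0..1} (\<lambda>t. Sup {p. H e t p = a})"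

definition sigma_path :: "('e \<Rightarrow> real \<Rightarrow> real \<Rightarrow> real) \<Rightarrow> real \<Rightarrow> 'e list \<Rightarrow> real" where
  "sigma_path H a xi = (\<Sum>e\<leftarrow>xi. sigma H a e)"

definition S_a ::
  "'e set \<Rightarrow> ('e \<Rightarrow> 'v) \<Rightarrow> ('e \<Rightarrow> 'v) \<Rightarrow> ('e \<Rightarrow> real \<Rightarrow> real \<Rightarrow> real) \<Rightarrow> real \<Rightarrow> 'v \<Rightarrow> 'v \<Rightarrow> real" where
  "S_a E src tgt H a x y = Inf (sigma_path H a ` {xi. path_from_to E src tgt x y xi})"

definition DFE_at ::
  "'e set \<Rightarrow> ('e \<Rightarrow> 'v) \<Rightarrow> ('e \<Rightarrow> 'v) \<Rightarrow> ('e \<Rightarrow> 'e) \<Rightarrow> ('e \<Rightarrow> real \<Rightarrow> real \<Rightarrow> real) \<Rightarrow>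
   real \<Rightarrow> ('v \<Rightarrow> real) \<Rightarrow> 'v \<Rightarrow> bool" where
  "DFE_at E src tgt inv_e H a u x \<longleftrightarrow>
     u x = Min ((\<lambda>e. u (tgt e) + sigma H a (inv_e e)) ` {e\<in>E. src e = x})"

definition DFE_subsol ::
  "'e set \<Rightarrow> ('e \<Rightarrow> 'v) \<Rightarrow> ('e \<Rightarrow> 'v) \<Rightarrow> ('e \<Rightarrow> real \<Rightarrow> real \<Rightarrow> real) \<Rightarrow>
   real \<Rightarrow> ('v \<Rightarrow> real) \<Rightarrow> bool" where
  "DFE_subsol E src tgt H a u \<longleftrightarrow> (\<forall>e\<in>E. u (tgt e) - u (src e) \<le> sigma H a e)"

definition crit_c ::
  "'e set \<Rightarrow> ('e \<Rightarrow> 'v) \<Rightarrow> ('e \<Rightarrow> 'v) \<Rightarrow> ('e \<Rightarrow> real \<Rightarrow> real \<Rightarrow> real) \<Rightarrow> real" where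
  "crit_c E src tgt H =
     Inf {a. a \<ge> a0 E src tgt H \<and> (\<exists>u. DFE_subsol E src tgt H a u)}"

end

theory Submission
  imports Defs
begin

text \<open>Since a exceeds the critical value, some level a' with a0 \<le> a' < a admits a subsolution u,
  and u is strict at level a: every sublevel set of H(t,.) at a level \<ge> a0 is nonempty (for a
  loop because a periodic viscosity subsolution forces this), so the largest root of H(t,.) = a'
  lies strictly below that of H(t,.) = a and depends continuously on t, whence sigma_a' < sigma_a
  on every arc. The extension v is a subsolution by the triangle inequality for S_a, and it solves
  (DFE_a) off V' because an optimal path from V' can be split at its last arc. Uniqueness is a
  comparison principle: mixing a solution with a small multiple of the strict subsolution makes it
  strict off V', so its difference with another solution is maximal on V', where both equal g.\<close>

section \<open>Hamiltonians and the largest root of H(t,.) = b\<close>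

lemma hamiltonian_ok_continuous_on:
  assumes "hamiltonian_ok h" and "S \<subseteq> {0..1} \<times> UNIV"
  shows "continuous_on S (\<lambda>z. h (fst z) (snd z))"
proof -
  have "continuous_on ({0..1} \<times> UNIV) (\<lambda>(s, p). h s p)"
    using assms(1) unfolding hamiltonian_ok_def by blast
  then show ?thesis
    using continuous_on_subset[OF _ assms(2)] by (simp add: case_prod_beta)
qed

lemma hamiltonian_ok_continuous_on_p:
  assumes "hamiltonian_ok h" and "t \<in> {0..1}"
  shows "continuous_on UNIV (h t)"
proof -
  have "continuous_on UNIV (\<lambda>p. h (fst (t, p)) (snd (t, p)))"
    by (rule continuous_on_compose2[OF hamiltonian_ok_continuous_on[OF assms(1) order_refl]])
       (use assms(2) in \<open>auto intro!: continuous_intros\<close>)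
  then show ?thesis by simp
qed

lemma hamiltonian_ok_continuous_on_s:
  assumes "hamiltonian_ok h"
  shows "continuous_on {0..1} (\<lambda>s. h s p)"
proof -
  have "continuous_on {0..1} (\<lambda>s. h (fst (s, p)) (snd (s, p)))"
    by (rule continuous_on_compose2[OF hamiltonian_ok_continuous_on[OF assms order_refl]])
       (auto intro!: continuous_intros)
  then show ?thesis by simp
qed

lemma hamiltonian_ok_coercive:
  assumes "hamiltonian_ok h"
  obtains R where "R > 0" "\<And>s p. s \<in> {0..1} \<Longrightarrow> \<bar>p\<bar> \<ge> R \<Longrightarrow> h s p \<ge> M"
proof -
  obtain R where "\<forall>s\<in>{0..1}. \<forall>p. \<bar>p\<bar> \<ge> R \<longrightarrow> h s p \<ge> M"
    using assms unfolding hamiltonian_ok_def by blast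
  then show ?thesis
    by (intro that[of "max R 1"]) auto
qed

lemma hamiltonian_ok_bounded_in_s:
  assumes "hamiltonian_ok h"
  obtains B where "\<And>s. s \<in> {0..1} \<Longrightarrow> h s p \<le> B"
proof -
  have "compact ((\<lambda>s. h s p) ` {0..1})"
    by (intro compact_continuous_image hamiltonian_ok_continuous_on_s[OF assms]) auto
  then obtain B where "\<forall>x\<in>(\<lambda>s. h s p) ` {0..1}. \<bar>x\<bar> \<le> B"
    using compact_imp_bounded bounded_real by metis
  then show ?thesis
    using that[of B] by (auto simp: abs_le_iff)
qed

lemma minH_attained:
  assumes h: "hamiltonian_ok h" and t: "t \<in> {0..1}"
  obtains q where "minH h t = h t q" "\<And>p. h t q \<le> h t p"
proof -
  obtain R where R: "R > 0" "\<And>s p. s \<in> {0..1} \<Longrightarrow> \<bar>p\<bar> \<ge> R \<Longrightarrow> h s p \<ge> h t 0"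
    using hamiltonian_ok_coercive[OF h] by blast
  have "continuous_on {-R..R} (h t)"
    using hamiltonian_ok_continuous_on_p[OF h t] continuous_on_subset by blast
  then obtain q where q: "q \<in> {-R..R}" "\<forall>p\<in>{-R..R}. h t q \<le> h t p"
    using continuous_attains_inf[of "{-R..R}" "h t"] R(1) by auto
  have min: "h t q \<le> h t p" for p
  proof (cases "\<bar>p\<bar> \<ge> R")
    case True
    then have "h t 0 \<le> h t p"
      using R(2) t by blast
    moreover have "h t q \<le> h t 0"
      using q R(1) by auto
    ultimately show ?thesis by linarith
  next
    case False
    then have "p \<in> {-R..R}" by auto
    then show ?thesis
      using q(2) by blast
  qed
  have "minH h t = h t q"
    unfolding minH_def by (rule cInf_eq_minimum) (use min in auto)
  with min show thesis
    using that by blast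
qed

lemma minH_le:
  assumes "hamiltonian_ok h" and "t \<in> {0..1}"
  shows "minH h t \<le> h t p"
  by (metis assms minH_attained)

definition max_root :: "(real \<Rightarrow> real \<Rightarrow> real) \<Rightarrow> real \<Rightarrow> real \<Rightarrow> real" where
  "max_root h b t = Sup {p. h t p = b}"

lemma sigma_eq_integral_max_root: "sigma H a e = integral {0..1} (max_root (H e) a)"
  unfolding sigma_def max_root_def ..

lemma max_root:
  assumes h: "hamiltonian_ok h" and t: "t \<in> {0..1}" and p0: "h t p0 \<le> b"
  shows max_root_root: "h t (max_root h b t) = b"
    and max_root_upper: "\<And>p. h t p \<le> b \<Longrightarrow> p \<le> max_root h b t"
proof -
  obtain R where R: "R > 0" "\<And>s p. s \<in> {0..1} \<Longrightarrow> \<bar>p\<bar> \<ge> R \<Longrightarrow> h s p \<ge> b + 1"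
    using hamiltonian_ok_coercive[OF h] by blast
  let ?L = "{p. h t p \<le> b}"
  have cont: "continuous_on UNIV (h t)"
    using hamiltonian_ok_continuous_on_p[OF h t] .
  have closed: "closed ?L"
    using closed_Collect_le[OF cont continuous_on_const] .
  have bounded: "p \<in> ?L \<Longrightarrow> \<bar>p\<bar> < R" for p
    using R(2)[OF t, of p] by force
  then have bdd: "bdd_above ?L"
    by (meson abs_less_iff bdd_above.I less_imp_le mem_Collect_eq)
  define q where "q = Sup ?L"
  have qL: "q \<in> ?L"
    unfolding q_def using closed_contains_Sup[OF _ bdd closed] p0 by blast
  have q_upper: "p \<in> ?L \<Longrightarrow> p \<le> q" for p
    unfolding q_def using cSup_upper[OF _ bdd] by blast
  have q_root: "h t q = b"
  proof (rule ccontr)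
    assume "h t q \<noteq> b"
    with qL have "h t q < b" by simp
    moreover have "q \<le> R" "h t R \<ge> b + 1"
      using bounded[OF qL] R(1) R(2)[OF t, of R] by auto
    ultimately obtain x where "q \<le> x" "x \<le> R" "h t x = b"
      using IVT'[of "h t" q b R] continuous_on_subset[OF cont] by force
    with q_upper \<open>h t q < b\<close> show False by force
  qed
  have "max_root h b t = q"
    unfolding max_root_def by (rule cSup_eq_maximum) (use q_root q_upper in auto)
  then show "h t (max_root h b t) = b" "\<And>p. h t p \<le> b \<Longrightarrow> p \<le> max_root h b t"
    using q_root q_upper by auto
qed

lemma closed_sublevel_projection:
  assumes h: "hamiltonian_ok h" and I: "compact I"
  shows "closed {s \<in> {0..1}. \<exists>p\<in>I. h s p \<le> b}"
proof -
  define K where "K = {z \<in> {0..1} \<times> I. h (fst z) (snd z) \<le> b}"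
  have cS: "compact ({0..1::real} \<times> I)"
    using I by (simp add: compact_Times)
  have "closed K"
    unfolding K_def
    by (rule continuous_on_closed_Collect_le)
       (auto intro!: hamiltonian_ok_continuous_on[OF h] continuous_intros compact_imp_closed[OF cS])
  moreover have "K = ({0..1} \<times> I) \<inter> K"
    unfolding K_def by auto
  ultimately have "compact K"
    by (metis compact_Int_closed[OF cS])
  then have "closed (fst ` K)"
    by (intro compact_imp_closed compact_continuous_image continuous_intros)
  moreover have "fst ` K = {s \<in> {0..1}. \<exists>p\<in>I. h s p \<le> b}"
    unfolding K_def by force
  ultimately show ?thesis by simp
qed

lemma sublevel_avoidance_near:
  assumes h: "hamiltonian_ok h" and I: "compact I" and t0: "t0 \<in> {0..1}"
    and above: "\<forall>p\<in>I. b < h t0 p"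
  obtains d where "d > 0" "\<And>s p. s \<in> {0..1} \<Longrightarrow> dist s t0 < d \<Longrightarrow> p \<in> I \<Longrightarrow> b < h s p"
proof -
  let ?T = "{s \<in> {0..1}. \<exists>p\<in>I. h s p \<le> b}"
  have "open (- ?T)" "t0 \<in> - ?T"
    using closed_sublevel_projection[OF h I] above by (auto simp: open_Compl)
  then obtain d where "d > 0" "ball t0 d \<subseteq> - ?T"
    using open_contains_ball by blast
  then show thesis
    by (intro that[of d]) (auto simp: dist_commute subset_iff not_le)
qed

context
  fixes h :: "real \<Rightarrow> real \<Rightarrow> real" and b :: real
  assumes h: "hamiltonian_ok h" and sublevel: "\<forall>t\<in>{0..1}. \<exists>p. h t p \<le> b"
begin

lemma max_root_bounded: "\<exists>R. \<forall>s\<in>{0..1}. \<bar>max_root h b s\<bar> < R"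
proof -
  obtain R where R: "\<And>s p. s \<in> {0..1} \<Longrightarrow> \<bar>p\<bar> \<ge> R \<Longrightarrow> h s p \<ge> b + 1"
    using hamiltonian_ok_coercive[OF h] by blast
  have "h s (max_root h b s) = b" if "s \<in> {0..1}" for s
    using max_root_root[OF h that] sublevel that by force
  then have "\<bar>max_root h b s\<bar> < R" if "s \<in> {0..1}" for s
    using R[OF that, of "max_root h b s"] that by force
  then show ?thesis
    by blast
qed

lemma max_root_eventually_below:
  assumes t0: "t0 \<in> {0..1}" and e: "e > 0"
  obtains d where "d > 0"
    "\<And>s. s \<in> {0..1} \<Longrightarrow> dist s t0 < d \<Longrightarrow> max_root h b s < max_root h b t0 + e"
proof -
  obtain R where R: "\<And>s. s \<in> {0..1} \<Longrightarrow> \<bar>max_root h b s\<bar> < R"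
    using max_root_bounded by blast
  have "\<forall>p\<in>{max_root h b t0 + e..R}. b < h t0 p"
  proof
    fix p assume "p \<in> {max_root h b t0 + e..R}"
    then have "\<not> p \<le> max_root h b t0"
      using e by auto
    then show "b < h t0 p"
      by (meson max_root_upper[OF h t0] not_le)
  qed
  then obtain d where d: "d > 0"
    "\<And>s p. s \<in> {0..1} \<Longrightarrow> dist s t0 < d \<Longrightarrow> p \<in> {max_root h b t0 + e..R} \<Longrightarrow> b < h s p"
    using sublevel_avoidance_near[OF h compact_Icc t0] by blast
  show thesis
  proof (rule that[OF d(1)])
    fix s assume s: "s \<in> {0..1}" "dist s t0 < d"
    have "h s (max_root h b s) = b"
      using max_root_root[OF h s(1)] sublevel s(1) by blast
    then have "max_root h b s \<notin> {max_root h b t0 + e..R}"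
      using d(2)[OF s, of "max_root h b s"] by force
    then show "max_root h b s < max_root h b t0 + e"
      using R[OF s(1)] by auto
  qed
qed

lemma max_root_eventually_above:
  assumes t0: "t0 \<in> {0..1}" and e: "e > 0"
  obtains d where "d > 0"
    "\<And>s. s \<in> {0..1} \<Longrightarrow> dist s t0 < d \<Longrightarrow> max_root h b t0 - e < max_root h b s"
proof -
  define P0 where "P0 = max_root h b t0"
  have P0: "h t0 P0 = b" "\<And>p. h t0 p \<le> b \<Longrightarrow> p \<le> P0"
    unfolding P0_def using max_root[OF h t0] sublevel t0 by blast+
  obtain R where R: "\<And>s. s \<in> {0..1} \<Longrightarrow> \<bar>max_root h b s\<bar> < R"
    using max_root_bounded by blast
  consider (isolated) "\<forall>p\<in>{-R..P0 - e}. b < h t0 p" | (wide) q where "q \<le> P0 - e" "h t0 q \<le> b"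
    by force
  then show thesis
  proof cases
    case isolated
    then obtain d where d: "d > 0"
      "\<And>s p. s \<in> {0..1} \<Longrightarrow> dist s t0 < d \<Longrightarrow> p \<in> {-R..P0 - e} \<Longrightarrow> b < h s p"
      using sublevel_avoidance_near[OF h compact_Icc t0] by blast
    show thesis
    proof (rule that[OF d(1)])
      fix s assume s: "s \<in> {0..1}" "dist s t0 < d"
      have "h s (max_root h b s) = b"
        using max_root_root[OF h s(1)] sublevel s(1) by blast
      then have "max_root h b s \<notin> {-R..P0 - e}"
        using d(2)[OF s, of "max_root h b s"] by force
      then show "max_root h b t0 - e < max_root h b s"
        using R[OF s(1)] unfolding P0_def by auto
    qed
  next
    case wide
    \<comment> \<open>By quasiconvexity [q, P0] lies in the sublevel set, so (q, P0) lies in its interior,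
      which is the strict sublevel set.\<close>
    have "is_interval {p. h t0 p \<le> b}"
      using h t0 is_interval_convex_1 unfolding hamiltonian_ok_def by blast
    then have "{q<..<P0} \<subseteq> {p. h t0 p \<le> b}"
      using wide(2) P0(1) unfolding is_interval_1
      by (smt (verit, best) greaterThanLessThan_iff mem_Collect_eq subsetI)
    then have "{q<..<P0} \<subseteq> interior {p. h t0 p \<le> b}"
      by (rule interior_maximal) auto
    also have "\<dots> = {p. h t0 p < b}"
      using h t0 unfolding hamiltonian_ok_def by blast
    finally have strict: "{q<..<P0} \<subseteq> {p. h t0 p < b}" .
    have "P0 - e/2 \<in> {q<..<P0}"
      using wide(1) e by auto
    with strict have below: "h t0 (P0 - e/2) < b"
      by blast
    have "\<exists>d>0. \<forall>s\<in>{0..1}. dist s t0 < d \<longrightarrow> dist (h s (P0 - e/2)) (h t0 (P0 - e/2)) < b - h t0 (P0 - e/2)"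
      using continuous_on_iff[THEN iffD1, OF hamiltonian_ok_continuous_on_s[OF h, of "P0 - e/2"]] t0 below
      by simp
    then obtain d where d: "d > 0"
      "\<And>s. s \<in> {0..1} \<Longrightarrow> dist s t0 < d \<Longrightarrow> dist (h s (P0 - e/2)) (h t0 (P0 - e/2)) < b - h t0 (P0 - e/2)"
      by blast
    show thesis
    proof (rule that[OF d(1)])
      fix s assume s: "s \<in> {0..1}" "dist s t0 < d"
      then have "dist (h s (P0 - e/2)) (h t0 (P0 - e/2)) < b - h t0 (P0 - e/2)"
        by (rule d(2))
      then have "h s (P0 - e/2) \<le> b"
        by (simp add: dist_real_def abs_less_iff)
      then have "P0 - e/2 \<le> max_root h b s"
        using max_root_upper[OF h s(1)] by blast
      then show "max_root h b t0 - e < max_root h b s"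
        using e unfolding P0_def by simp
    qed
  qed
qed

lemma continuous_on_max_root: "continuous_on {0..1} (max_root h b)"
  unfolding continuous_on_iff
proof (intro ballI allI impI)
  fix t0 e :: real assume t0: "t0 \<in> {0..1}" and e: "e > 0"
  obtain d1 where d1: "d1 > 0"
    "\<And>s. s \<in> {0..1} \<Longrightarrow> dist s t0 < d1 \<Longrightarrow> max_root h b s < max_root h b t0 + e"
    using max_root_eventually_below[OF t0 e] by blast
  obtain d2 where d2: "d2 > 0"
    "\<And>s. s \<in> {0..1} \<Longrightarrow> dist s t0 < d2 \<Longrightarrow> max_root h b t0 - e < max_root h b s"
    using max_root_eventually_above[OF t0 e] by blast
  show "\<exists>d>0. \<forall>s\<in>{0..1}. dist s t0 < d \<longrightarrow> dist (max_root h b s) (max_root h b t0) < e"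
  proof (intro exI[of _ "min d1 d2"] conjI ballI impI)
    fix s assume "s \<in> {0..1}" "dist s t0 < min d1 d2"
    then have "max_root h b s < max_root h b t0 + e" "max_root h b t0 - e < max_root h b s"
      using d1(2) d2(2) by auto
    then show "dist (max_root h b s) (max_root h b t0) < e"
      by (simp add: dist_real_def abs_less_iff)
  qed (use d1 d2 in simp)
qed

end

lemma integral_strict_mono_continuous:
  fixes f g :: "real \<Rightarrow> real"
  assumes f: "continuous_on {0..1} f" and g: "continuous_on {0..1} g"
    and less: "\<And>t. t \<in> {0..1} \<Longrightarrow> f t < g t"
  shows "integral {0..1} f < integral {0..1} g"
proof -
  have gap: "continuous_on {0..1} (\<lambda>t. g t - f t)"
    using f g by (intro continuous_intros)
  obtain t1 where t1: "t1 \<in> {0..1}" "\<forall>t\<in>{0..1}. g t1 - f t1 \<le> g t - f t"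
    using continuous_attains_inf[OF compact_Icc _ gap] by auto
  have "0 < g t1 - f t1"
    using less[OF t1(1)] by simp
  also have "\<dots> = integral {0..1} (\<lambda>t::real. g t1 - f t1)"
    by simp
  also have "\<dots> \<le> integral {0..1} (\<lambda>t. g t - f t)"
    using t1(2) integrable_continuous_interval[OF gap] by (intro integral_le) auto
  also have "\<dots> = integral {0..1} g - integral {0..1} f"
    using f g by (intro integral_diff integrable_continuous_interval)
  finally show ?thesis by simp
qed

lemma sigma_strict_mono:
  assumes h: "hamiltonian_ok (H e)" and sublevel: "\<forall>t\<in>{0..1}. \<exists>p. H e t p \<le> a'"
    and less: "a' < a"
  shows "sigma H a' e < sigma H a e"
  unfolding sigma_eq_integral_max_root
proof (rule integral_strict_mono_continuous[OF continuous_on_max_root continuous_on_max_root])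
  have sublevel_a: "\<forall>t\<in>{0..1}. \<exists>p. H e t p \<le> a"
    using sublevel less by (meson less_imp_le order_trans)
  show "hamiltonian_ok (H e)" "\<forall>t\<in>{0..1}. \<exists>p. H e t p \<le> a'"
    "hamiltonian_ok (H e)" "\<forall>t\<in>{0..1}. \<exists>p. H e t p \<le> a"
    using h sublevel sublevel_a by auto
  fix t :: real assume t: "t \<in> {0..1}"
  then obtain p where p: "H e t p \<le> a'"
    using sublevel by blast
  have root': "H e t (max_root (H e) a' t) = a'"
    using max_root_root[OF h t p] .
  then have "max_root (H e) a' t \<le> max_root (H e) a t"
    using max_root_upper[OF h t, of p a] p less by simp
  moreover have "max_root (H e) a' t \<noteq> max_root (H e) a t"
    using root' max_root_root[OF h t, of p a] p less by auto
  ultimately show "max_root (H e) a' t < max_root (H e) a t"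
    by simp
qed

section \<open>Sublevel sets at levels above a0\<close>

lemma periodic_subsol_sublevel_near:
  assumes h: "hamiltonian_ok h" and sub: "periodic_subsol h b u"
    and t0: "0 < t0" "t0 < 1" and e: "e > 0"
  obtains s p where "0 < s" "s < 1" "\<bar>s - t0\<bar> < e" "h s p \<le> b"
proof -
  have vs: "visc_subsol (\<lambda>s p. h (frac s) p) b u"
    using sub unfolding periodic_subsol_def by blast
  have u_cont: "continuous_on UNIV u"
    and test: "\<And>s d \<phi>. (\<phi> has_real_derivative d) (at s) \<Longrightarrow>
        \<exists>\<delta>>0. \<forall>r. \<bar>r - s\<bar> < \<delta> \<longrightarrow> u r - \<phi> r \<le> u s - \<phi> s \<Longrightarrow> h (frac s) d \<le> b"
    using vs unfolding visc_subsol_def by blast+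
  define I where "I = {t0 - 1 .. t0 + 1}"
  have "compact (u ` I)"
    unfolding I_def by (intro compact_continuous_image continuous_on_subset[OF u_cont]) auto
  then have "bounded (u ` I)"
    by (rule compact_imp_bounded)
  then obtain M where M: "\<And>r. r \<in> I \<Longrightarrow> \<bar>u r\<bar> \<le> M"
    unfolding bounded_real by blast
  have M0: "M \<ge> 0"
    using M[of t0] unfolding I_def by auto
  define dl where "dl = min (min e 1) (min t0 (1 - t0))"
  have dl: "dl > 0" "dl \<le> e" "dl \<le> t0" "dl \<le> 1 - t0"
    using e t0 unfolding dl_def by auto
  \<comment> \<open>Touch u from above by the steep parabola centred at t0; the contact point s is close to t0.\<close>
  define ep where "ep = dl\<^sup>2 / (2 * M + 1)"
  have ep: "ep > 0"
    unfolding ep_def using dl M0 by auto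
  define f where "f r = u r - (r - t0)\<^sup>2 / ep" for r
  have "continuous_on I f"
    unfolding f_def by (intro continuous_intros continuous_on_subset[OF u_cont]) (use ep in auto)
  then obtain s where s: "s \<in> I" "\<forall>r\<in>I. f r \<le> f s"
    using continuous_attains_sup[of I f] unfolding I_def by auto
  have "f t0 \<le> f s"
    using s(2) unfolding I_def by auto
  then have "(s - t0)\<^sup>2 / ep \<le> u s - u t0"
    unfolding f_def by simp
  also have "\<dots> \<le> 2 * M"
    using M[OF s(1)] M[of t0] unfolding I_def by auto
  finally have "(s - t0)\<^sup>2 \<le> 2 * M * ep"
    using ep by (simp add: divide_le_eq)
  also have "\<dots> < dl\<^sup>2"
    unfolding ep_def using dl M0 by (simp add: field_simps)
  finally have "\<bar>s - t0\<bar>\<^sup>2 < dl\<^sup>2"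
    by simp
  then have close: "\<bar>s - t0\<bar> < dl"
    by (rule power2_less_imp_less) (use dl in simp)
  then have s01: "0 < s" "s < 1"
    using dl by auto
  have der: "((\<lambda>r. (r - t0)\<^sup>2 / ep) has_real_derivative (2 * (s - t0) / ep)) (at s)"
    using ep by (auto intro!: derivative_eq_intros)
  have "\<forall>r. \<bar>r - s\<bar> < 1 - \<bar>s - t0\<bar> \<longrightarrow> u r - (r - t0)\<^sup>2 / ep \<le> u s - (s - t0)\<^sup>2 / ep"
  proof (intro allI impI)
    fix r assume "\<bar>r - s\<bar> < 1 - \<bar>s - t0\<bar>"
    then have "r \<in> I"
      unfolding I_def by auto
    then show "u r - (r - t0)\<^sup>2 / ep \<le> u s - (s - t0)\<^sup>2 / ep"
      using s(2) unfolding f_def by blast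
  qed
  moreover have "0 < 1 - \<bar>s - t0\<bar>"
    using close dl by auto
  ultimately have "h (frac s) (2 * (s - t0) / ep) \<le> b"
    by (intro test[OF der]) blast
  moreover have "frac s = s"
    using s01 by (simp add: frac_eq)
  ultimately show thesis
    using that[of s] s01 close dl by auto
qed

lemma periodic_subsol_sublevel_nonempty:
  assumes h: "hamiltonian_ok h" and sub: "periodic_subsol h b u" and t: "t \<in> {0..1}"
  shows "\<exists>p. h t p \<le> b"
proof -
  obtain R where R: "\<And>s p. s \<in> {0..1} \<Longrightarrow> \<bar>p\<bar> \<ge> R \<Longrightarrow> h s p \<ge> b + 1"
    using hamiltonian_ok_coercive[OF h] by blast
  let ?T = "{s \<in> {0..1}. \<exists>p\<in>{-R..R}. h s p \<le> b}"
  have closed: "closed ?T"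
    by (rule closed_sublevel_projection[OF h compact_Icc])
  have "t0 \<in> ?T" if "0 < t0" "t0 < 1" for t0
  proof -
    have "\<exists>s\<in>?T. dist s t0 < e" if "e > 0" for e
    proof -
      obtain s p where sp: "0 < s" "s < 1" "\<bar>s - t0\<bar> < e" "h s p \<le> b"
        using periodic_subsol_sublevel_near[OF h sub \<open>0 < t0\<close> \<open>t0 < 1\<close> \<open>e > 0\<close>] .
      moreover have "\<bar>p\<bar> < R"
        using R[of s p] sp by force
      ultimately have "s \<in> ?T"
        by (intro CollectI conjI bexI[of _ p]) auto
      then show ?thesis
        using sp(3) by (intro bexI[of _ s]) (auto simp: dist_real_def)
    qed
    then show ?thesis
      using closed_approachable[OF closed] by blast
  qed
  then have "closure {0<..<1::real} \<subseteq> ?T"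
    by (intro closure_minimal[OF _ closed]) auto
  then show ?thesis
    using t by auto
qed

lemma periodic_subsol_const:
  assumes "\<And>s. s \<in> {0..1} \<Longrightarrow> h s 0 \<le> B"
  shows "periodic_subsol h B (\<lambda>_. c)"
  unfolding periodic_subsol_def visc_subsol_def
proof (intro conjI allI impI)
  fix s d \<phi>
  assume "(\<phi> has_real_derivative d) (at s) \<and> (\<exists>\<delta>>0. \<forall>r. \<bar>r - s\<bar> < \<delta> \<longrightarrow> c - \<phi> r \<le> c - \<phi> s)"
  then obtain \<delta> where der: "(\<phi> has_real_derivative d) (at s)" and "\<delta> > 0"
    and "\<forall>r. \<bar>r - s\<bar> < \<delta> \<longrightarrow> c - \<phi> r \<le> c - \<phi> s"
    by blast
  then have "d = 0"
    by (intro DERIV_local_min[OF der \<open>\<delta> > 0\<close>]) (simp add: abs_minus_commute)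
  moreover have "frac s \<in> {0..1}"
    using frac_ge_0[of s] frac_lt_1[of s] by auto
  ultimately show "h (frac s) d \<le> B"
    using assms by simp
qed simp_all

lemma minH_le_c_arc:
  assumes h: "hamiltonian_ok h" and t: "t \<in> {0..1}"
  shows "minH h t \<le> c_arc h"
proof -
  obtain B where "\<And>s. s \<in> {0..1} \<Longrightarrow> h s 0 \<le> B"
    using hamiltonian_ok_bounded_in_s[OF h] by blast
  then have "{b. \<exists>u. periodic_subsol h b u} \<noteq> {}"
    using periodic_subsol_const by blast
  then show ?thesis
    unfolding c_arc_def
  proof (rule cInf_greatest)
    fix b assume "b \<in> {b. \<exists>u. periodic_subsol h b u}"
    then obtain p where "h t p \<le> b"
      using periodic_subsol_sublevel_nonempty[OF h _ t] by blast
    then show "minH h t \<le> b"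
      using minH_le[OF h t, of p] by simp
  qed
qed

lemma minH_le_maxminH:
  assumes h: "hamiltonian_ok h" and t: "t \<in> {0..1}"
  shows "minH h t \<le> maxminH h"
proof -
  obtain B where B: "\<And>s. s \<in> {0..1} \<Longrightarrow> h s 0 \<le> B"
    using hamiltonian_ok_bounded_in_s[OF h] by blast
  have "bdd_above (minH h ` {0..1})"
    using minH_le[OF h, of _ 0] B by (intro bdd_aboveI2[where M = B]) (meson order_trans)
  then show ?thesis
    unfolding maxminH_def using t by (simp add: cSup_upper)
qed

lemma graph_okD:
  assumes "graph_ok V E src tgt inv_e"
  shows "finite E" and "V = src ` E"
    and "e \<in> E \<Longrightarrow> tgt e \<in> V" and "e \<in> E \<Longrightarrow> inv_e e \<in> E"
    and "e \<in> E \<Longrightarrow> src (inv_e e) = tgt e" and "e \<in> E \<Longrightarrow> tgt (inv_e e) = src e"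
    and "e \<in> E \<Longrightarrow> inv_e (inv_e e) = e"
  using assms unfolding graph_ok_def by auto

lemma sublevel_nonempty_a0:
  assumes graph: "graph_ok V E src tgt inv_e" and h: "hamiltonian_ok (H e)"
    and e: "e \<in> E" and t: "t \<in> {0..1}"
  shows "\<exists>p. H e t p \<le> a0 E src tgt H"
proof -
  have fin: "finite E"
    using graph_okD(1)[OF graph] .
  have "minH (H e) t \<le> a0 E src tgt H"
  proof (cases "src e = tgt e")
    case True
    then have "c_arc (H e) \<le> a0 E src tgt H"
      unfolding a0_def using e fin by (intro Max_ge) auto
    then show ?thesis
      using minH_le_c_arc[OF h t] by linarith
  next
    case False
    then have "maxminH (H e) \<le> a0 E src tgt H"
      unfolding a0_def using e fin by (intro Max_ge) auto
    then show ?thesis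
      using minH_le_maxminH[OF h t] by linarith
  qed
  moreover obtain q where "minH (H e) t = H e t q"
    using minH_attained[OF h t] by metis
  ultimately show ?thesis
    by auto
qed

section \<open>Strict subsolutions above the critical value\<close>

definition DFE_strict_subsol ::
  "'e set \<Rightarrow> ('e \<Rightarrow> 'v) \<Rightarrow> ('e \<Rightarrow> 'v) \<Rightarrow> ('e \<Rightarrow> real \<Rightarrow> real \<Rightarrow> real) \<Rightarrow>
   real \<Rightarrow> ('v \<Rightarrow> real) \<Rightarrow> bool" where
  "DFE_strict_subsol E src tgt H a u \<longleftrightarrow> (\<forall>e\<in>E. u (tgt e) - u (src e) < sigma H a e)"

lemma DFE_strict_subsol_imp_subsol:
  "DFE_strict_subsol E src tgt H a u \<Longrightarrow> DFE_subsol E src tgt H a u"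
  unfolding DFE_strict_subsol_def DFE_subsol_def by (simp add: less_imp_le)

lemma DFE_subsol_zero_at_large_level:
  assumes net: "network_ok V E src tgt inv_e H"
  shows "\<exists>b \<ge> a0 E src tgt H. DFE_subsol E src tgt H b (\<lambda>_. 0)"
proof -
  have fin: "finite E" and hs: "\<forall>e\<in>E. hamiltonian_ok (H e)"
    using net unfolding network_ok_def graph_ok_def by auto
  have "\<forall>e\<in>E. \<exists>B. \<forall>s\<in>{0..1}. H e s 0 \<le> B"
    using hamiltonian_ok_bounded_in_s hs by metis
  then obtain B where B: "\<forall>e\<in>E. \<forall>s\<in>{0..1}. H e s 0 \<le> B e"
    by metis
  define b where "b = max (a0 E src tgt H) (Max (insert 0 (B ` E)))"
  have below_b: "H e s 0 \<le> b" if "e \<in> E" "s \<in> {0..1}" for e s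
  proof -
    have "B e \<le> Max (insert 0 (B ` E))"
      using fin that(1) by simp
    then show ?thesis
      using B that unfolding b_def by force
  qed
  have "0 \<le> sigma H b e" if e: "e \<in> E" for e
    unfolding sigma_eq_integral_max_root
  proof (rule integral_nonneg)
    have h: "hamiltonian_ok (H e)"
      using hs e by blast
    show "max_root (H e) b integrable_on {0..1}"
      using continuous_on_max_root[OF h] below_b e integrable_continuous_interval by blast
    show "0 \<le> max_root (H e) b t" if "t \<in> {0..1}" for t
      using max_root_upper[OF h that below_b[OF e that]] below_b[OF e that] .
  qed
  moreover have "a0 E src tgt H \<le> b"
    unfolding b_def by simp
  ultimately show ?thesis
    unfolding DFE_subsol_def by auto
qed

lemma strict_subsol_above_crit:
  assumes net: "network_ok V E src tgt inv_e H" and a: "a > crit_c E src tgt H"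
  obtains u where "DFE_strict_subsol E src tgt H a u"
proof -
  let ?A = "{a. a \<ge> a0 E src tgt H \<and> (\<exists>u. DFE_subsol E src tgt H a u)}"
  have "?A \<noteq> {}"
    using DFE_subsol_zero_at_large_level[OF net] by blast
  then obtain a' u where a': "a0 E src tgt H \<le> a'" "a' < a" and u: "DFE_subsol E src tgt H a' u"
    using cInf_lessD[of ?A a] a unfolding crit_c_def by blast
  have graph: "graph_ok V E src tgt inv_e" and hs: "\<forall>e\<in>E. hamiltonian_ok (H e)"
    using net unfolding network_ok_def by auto
  have "sigma H a' e < sigma H a e" if e: "e \<in> E" for e
  proof (rule sigma_strict_mono[OF _ _ a'(2)])
    show h: "hamiltonian_ok (H e)"
      using hs e by blast
    show "\<forall>t\<in>{0..1}. \<exists>p. H e t p \<le> a'"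
      using sublevel_nonempty_a0[where H = H, OF graph h e] a'(1) by (meson order_trans)
  qed
  then have "DFE_strict_subsol E src tgt H a u"
    using u unfolding DFE_subsol_def DFE_strict_subsol_def by (meson order_le_less_trans)
  then show thesis
    by (rule that)
qed

lemma is_path_Cons:
  "is_path E src tgt (e # xi) \<longleftrightarrow>
     e \<in> E \<and> (xi = [] \<or> (tgt e = src (hd xi) \<and> is_path E src tgt xi))"
  by (cases xi) (auto simp: is_path_def All_less_Suc2[where P = "\<lambda>j. Suc j < _ \<longrightarrow> _", simplified]
      less_Suc_eq_0_disj nth_Cons split: nat.splits)

lemma path_from_to_Cons:
  "path_from_to E src tgt x y (e # xi) \<longleftrightarrow>
     e \<in> E \<and> src e = x \<and> ((xi = [] \<and> tgt e = y) \<or> path_from_to E src tgt (tgt e) y xi)"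
  unfolding path_from_to_def is_path_Cons by (cases xi) (auto simp: is_path_def)

lemma not_path_from_to_Nil [simp]: "\<not> path_from_to E src tgt x y []"
  by (simp add: path_from_to_def is_path_def)

lemma path_from_to_snoc:
  "path_from_to E src tgt x y (xi @ [f]) \<longleftrightarrow>
     f \<in> E \<and> tgt f = y \<and> ((xi = [] \<and> src f = x) \<or> path_from_to E src tgt x (src f) xi)"
proof (induction xi arbitrary: x)
  case Nil
  then show ?case
    by (auto simp: path_from_to_Cons)
next
  case (Cons e xi)
  show ?case
    unfolding append_Cons path_from_to_Cons[of E src tgt x y e "xi @ [f]"]
      path_from_to_Cons[of E src tgt x "src f" e xi] Cons.IH
    by auto
qed

lemma sigma_path_Nil [simp]: "sigma_path H a [] = 0"
  by (simp add: sigma_path_def)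

lemma sigma_path_Cons [simp]: "sigma_path H a (e # xi) = sigma H a e + sigma_path H a xi"
  by (simp add: sigma_path_def)

lemma sigma_path_snoc [simp]: "sigma_path H a (xi @ [e]) = sigma_path H a xi + sigma H a e"
  by (simp add: sigma_path_def)

lemma DFE_subsol_le_sigma_path:
  assumes "DFE_subsol E src tgt H a u" and "path_from_to E src tgt x y xi"
  shows "u y - u x \<le> sigma_path H a xi"
  using assms(2)
proof (induction xi arbitrary: x)
  case Nil
  then show ?case by simp
next
  case (Cons e xi)
  then have e: "e \<in> E" "src e = x"
    by (auto simp: path_from_to_Cons)
  then have "u (tgt e) - u x \<le> sigma H a e"
    using assms(1) unfolding DFE_subsol_def by blast
  moreover have "u y - u (tgt e) \<le> sigma_path H a xi"
    if "path_from_to E src tgt (tgt e) y xi"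
    using Cons.IH that .
  ultimately show ?case
    using Cons.prems by (auto simp: path_from_to_Cons)
qed

section \<open>Comparison principle\<close>

lemma DFE_atD:
  assumes "DFE_at E src tgt inv_e H a u x" and "finite E" and "x \<in> src ` E"
  shows "\<And>e. e \<in> E \<Longrightarrow> src e = x \<Longrightarrow> u x \<le> u (tgt e) + sigma H a (inv_e e)"
    and "\<exists>e\<in>E. src e = x \<and> u x = u (tgt e) + sigma H a (inv_e e)"
proof -
  let ?F = "(\<lambda>e. u (tgt e) + sigma H a (inv_e e)) ` {e \<in> E. src e = x}"
  have fin: "finite ?F" and u_x: "u x = Min ?F"
    using assms unfolding DFE_at_def by auto
  show "\<And>e. e \<in> E \<Longrightarrow> src e = x \<Longrightarrow> u x \<le> u (tgt e) + sigma H a (inv_e e)"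
    using fin u_x by simp
  have "Min ?F \<in> ?F"
    using fin assms(3) by (intro Min_in) auto
  then show "\<exists>e\<in>E. src e = x \<and> u x = u (tgt e) + sigma H a (inv_e e)"
    using u_x by auto
qed

lemma finite_max_attained_in_subset:
  fixes f :: "'v \<Rightarrow> real"
  assumes "finite V" and "x \<in> V" and ascent: "\<And>x. x \<in> V - V' \<Longrightarrow> \<exists>y\<in>V. f x < f y"
  obtains x0 where "x0 \<in> V \<inter> V'" and "\<And>y. y \<in> V \<Longrightarrow> f y \<le> f x0"
proof -
  have "Max (f ` V) \<in> f ` V"
    using assms(1,2) by (intro Max_in) auto
  then obtain x0 where x0: "x0 \<in> V" "f x0 = Max (f ` V)"
    by (metis imageE)
  then have max: "\<And>y. y \<in> V \<Longrightarrow> f y \<le> f x0"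
    using assms(1) by simp
  then have "x0 \<in> V'"
    using ascent[of x0] x0(1) by force
  with x0(1) max show thesis
    using that by blast
qed

text \<open>Mixing w1 with a small multiple l of the strict subsolution u makes it a strict subsolution
  off V', so its difference with the supersolution w2 attains its maximum on V'; then let l tend
  to 0.\<close>

lemma DFE_comparison:
  assumes graph: "graph_ok V E src tgt inv_e" and strict: "DFE_strict_subsol E src tgt H a u"
    and sub: "\<And>x e. x \<in> V - V' \<Longrightarrow> e \<in> E \<Longrightarrow> src e = x \<Longrightarrow> w1 x \<le> w1 (tgt e) + sigma H a (inv_e e)"
    and super: "\<And>x. x \<in> V - V' \<Longrightarrow> \<exists>e\<in>E. src e = x \<and> w2 (tgt e) + sigma H a (inv_e e) \<le> w2 x"
    and boundary: "\<And>y. y \<in> V' \<Longrightarrow> w1 y \<le> w2 y"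
    and x: "x \<in> V"
  shows "w1 x \<le> w2 x"
proof -
  have finV: "finite V"
    using graph_okD(1,2)[OF graph] by simp
  define K where "K = Max ((\<lambda>y. u y - w2 y) ` V)"
  have mixed: "(1 - l) * (w1 x - w2 x) + l * (u x - w2 x - K) \<le> 0" if l: "0 < l" "l < 1" for l
  proof -
    define f where "f y = (1 - l) * (w1 y - w2 y) + l * (u y - w2 y)" for y
    have "\<exists>y\<in>V. f x1 < f y" if x1: "x1 \<in> V - V'" for x1
    proof -
      obtain e where e: "e \<in> E" "src e = x1" "w2 (tgt e) + sigma H a (inv_e e) \<le> w2 x1"
        using super[OF x1] by blast
      have "w1 x1 - w1 (tgt e) \<le> sigma H a (inv_e e)"
        using sub[OF x1 e(1,2)] by simp
      then have "(1 - l) * ((w1 x1 - w1 (tgt e)) - (w2 x1 - w2 (tgt e))) \<le> 0"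
        using e(3) l by (intro mult_nonneg_nonpos) auto
      moreover have "u x1 - u (tgt e) < sigma H a (inv_e e)"
        using strict graph_okD(4-6)[OF graph e(1)] e(2) unfolding DFE_strict_subsol_def by force
      then have "l * ((u x1 - u (tgt e)) - (w2 x1 - w2 (tgt e))) < 0"
        using e(3) l by (intro mult_pos_neg) auto
      ultimately have "f x1 < f (tgt e)"
        unfolding f_def by (simp add: algebra_simps)
      then show ?thesis
        using graph_okD(3)[OF graph e(1)] by blast
    qed
    then obtain x0 where x0: "x0 \<in> V \<inter> V'" "\<And>y. y \<in> V \<Longrightarrow> f y \<le> f x0"
      using finite_max_attained_in_subset[OF finV x] by blast
    have "f x0 \<le> l * (u x0 - w2 x0)"
      using boundary[of x0] x0(1) l unfolding f_def by (simp add: mult_nonneg_nonpos)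
    also have "\<dots> \<le> l * K"
      using x0(1) finV l unfolding K_def by (intro mult_left_mono Max_ge) auto
    finally show ?thesis
      using x0(2)[OF x] unfolding f_def by (simp add: algebra_simps)
  qed
  have "((\<lambda>l. (1 - l) * (w1 x - w2 x) + l * (u x - w2 x - K)) \<longlongrightarrow> w1 x - w2 x) (at_right 0)"
    by (auto intro!: tendsto_eq_intros)
  moreover have "\<forall>\<^sub>F l in at_right 0. (1 - l) * (w1 x - w2 x) + l * (u x - w2 x - K) \<le> 0"
    using mixed by (intro eventually_at_rightI[of 0 1]) auto
  ultimately have "w1 x - w2 x \<le> 0"
    by (rule tendsto_upperbound) simp
  then show ?thesis by simp
qed

lemma DFE_at_unique:
  assumes graph: "graph_ok V E src tgt inv_e" and strict: "DFE_strict_subsol E src tgt H a u"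
    and w1: "\<forall>x\<in>V - V'. DFE_at E src tgt inv_e H a w1 x"
    and w2: "\<forall>x\<in>V - V'. DFE_at E src tgt inv_e H a w2 x"
    and boundary: "\<forall>y\<in>V'. w1 y = w2 y" and x: "x \<in> V"
  shows "w1 x = w2 x"
proof -
  have at_x1: "DFE_at E src tgt inv_e H a w x1" "finite E" "x1 \<in> src ` E"
    if "\<forall>x\<in>V - V'. DFE_at E src tgt inv_e H a w x" "x1 \<in> V - V'" for w x1
    using that graph_okD(1,2)[OF graph] by auto
  have sub: "w x1 \<le> w (tgt e) + sigma H a (inv_e e)"
    if "\<forall>x\<in>V - V'. DFE_at E src tgt inv_e H a w x" "x1 \<in> V - V'" "e \<in> E" "src e = x1" for w x1 e
    using DFE_atD(1)[OF at_x1[OF that(1,2)] that(3,4)] .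
  have super: "\<exists>e\<in>E. src e = x1 \<and> w (tgt e) + sigma H a (inv_e e) \<le> w x1"
    if "\<forall>x\<in>V - V'. DFE_at E src tgt inv_e H a w x" "x1 \<in> V - V'" for w x1
    using DFE_atD(2)[OF at_x1[OF that]] by force
  have "w1 x \<le> w2 x"
    by (rule DFE_comparison[where V' = V', OF graph strict sub[OF w1] super[OF w2] _ x])
       (use boundary in auto)
  moreover have "w2 x \<le> w1 x"
    by (rule DFE_comparison[where V' = V', OF graph strict sub[OF w2] super[OF w1] _ x])
       (use boundary in auto)
  ultimately show ?thesis
    by simp
qed

section \<open>Extension of boundary data by S_a\<close>

definition S_extension ::
  "'e set \<Rightarrow> ('e \<Rightarrow> 'v) \<Rightarrow> ('e \<Rightarrow> 'v) \<Rightarrow> ('e \<Rightarrow> real \<Rightarrow> real \<Rightarrow> real) \<Rightarrow> real \<Rightarrow>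
   'v set \<Rightarrow> ('v \<Rightarrow> real) \<Rightarrow> 'v \<Rightarrow> real" where
  "S_extension E src tgt H a V' g x =
     (if x \<in> V' then g x else Min ((\<lambda>y. g y + S_a E src tgt H a y x) ` V'))"

context
  fixes V :: "'v set" and E :: "'e set" and src tgt :: "'e \<Rightarrow> 'v" and inv_e :: "'e \<Rightarrow> 'e"
    and H :: "'e \<Rightarrow> real \<Rightarrow> real \<Rightarrow> real" and a :: real
  assumes graph: "graph_ok V E src tgt inv_e"
    and conn: "connected_graph V E src tgt"
    and subsol: "\<exists>u. DFE_subsol E src tgt H a u"
begin

lemma path_from_to_exists:
  assumes "x \<in> V" and "y \<in> V"
  shows "\<exists>xi. path_from_to E src tgt x y xi"
proof (cases "x = y")
  case True
  obtain e where "e \<in> E" "src e = x"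
    using assms(1) graph_okD(2)[OF graph] by blast
  then have "path_from_to E src tgt x y [e, inv_e e]"
    using True graph_okD(4-6)[OF graph] by (simp add: path_from_to_Cons)
  then show ?thesis ..
next
  case False
  then show ?thesis
    using assms conn unfolding connected_graph_def by blast
qed

lemma S_a_le_sigma_path:
  assumes "path_from_to E src tgt x y xi"
  shows "S_a E src tgt H a x y \<le> sigma_path H a xi"
proof -
  obtain u where "DFE_subsol E src tgt H a u"
    using subsol by blast
  then have "bdd_below (sigma_path H a ` {xi. path_from_to E src tgt x y xi})"
    using DFE_subsol_le_sigma_path by (intro bdd_belowI2[where m = "u y - u x"]) auto
  then show ?thesis
    unfolding S_a_def using assms by (intro cInf_lower) auto
qed

lemma S_a_greatest:
  assumes "x \<in> V" and "y \<in> V" and "\<And>xi. path_from_to E src tgt x y xi \<Longrightarrow> c \<le> sigma_path H a xi"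
  shows "c \<le> S_a E src tgt H a x y"
  unfolding S_a_def using path_from_to_exists[OF assms(1,2)] assms(3) by (intro cInf_greatest) auto

lemma S_a_arc:
  assumes "e \<in> E"
  shows "S_a E src tgt H a (src e) (tgt e) \<le> sigma H a e"
  using S_a_le_sigma_path[of "src e" "tgt e" "[e]"] assms by (simp add: path_from_to_Cons)

lemma S_a_snoc_arc:
  assumes x: "x \<in> V" and e: "e \<in> E"
  shows "S_a E src tgt H a x (tgt e) \<le> S_a E src tgt H a x (src e) + sigma H a e"
proof -
  have "S_a E src tgt H a x (tgt e) - sigma H a e \<le> S_a E src tgt H a x (src e)"
  proof (rule S_a_greatest[OF x])
    show "src e \<in> V"
      using e graph_okD(2)[OF graph] by blast
    fix xi assume "path_from_to E src tgt x (src e) xi"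
    then have "path_from_to E src tgt x (tgt e) (xi @ [e])"
      using e by (simp add: path_from_to_snoc)
    then show "S_a E src tgt H a x (tgt e) - sigma H a e \<le> sigma_path H a xi"
      using S_a_le_sigma_path by fastforce
  qed
  then show ?thesis by simp
qed

context
  fixes V' :: "'v set" and g :: "'v \<Rightarrow> real"
  assumes V'_sub: "V' \<subseteq> V" and V'_ne: "V' \<noteq> {}"
    and g_comp: "\<forall>x\<in>V'. \<forall>y\<in>V'. g x - g y \<le> S_a E src tgt H a y x"
begin

lemma finite_V': "finite V'"
  using V'_sub graph_okD(1,2)[OF graph] finite_subset by blast

lemma S_extension_le:
  assumes "y \<in> V'"
  shows "S_extension E src tgt H a V' g x \<le> g y + S_a E src tgt H a y x"
  using assms g_comp finite_V' by (force simp: S_extension_def)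

lemma S_extension_attained:
  assumes "x \<notin> V'"
  obtains y where "y \<in> V'" "S_extension E src tgt H a V' g x = g y + S_a E src tgt H a y x"
proof -
  have "Min ((\<lambda>y. g y + S_a E src tgt H a y x) ` V') \<in> (\<lambda>y. g y + S_a E src tgt H a y x) ` V'"
    using finite_V' V'_ne by (intro Min_in) auto
  then show thesis
    using assms that unfolding S_extension_def by auto
qed

lemma DFE_subsol_S_extension: "DFE_subsol E src tgt H a (S_extension E src tgt H a V' g)"
  unfolding DFE_subsol_def
proof
  fix e assume e: "e \<in> E"
  let ?v = "S_extension E src tgt H a V' g"
  show "?v (tgt e) - ?v (src e) \<le> sigma H a e"
  proof (cases "src e \<in> V'")
    case True
    then show ?thesis
      using S_extension_le[OF True, of "tgt e"] S_a_arc[OF e] by (simp add: S_extension_def)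
  next
    case False
    then obtain y where y: "y \<in> V'" "?v (src e) = g y + S_a E src tgt H a y (src e)"
      by (rule S_extension_attained)
    then show ?thesis
      using S_extension_le[OF y(1), of "tgt e"] S_a_snoc_arc[of y e] e V'_sub by force
  qed
qed

lemma DFE_at_S_extension:
  assumes x: "x \<in> V - V'"
  shows "DFE_at E src tgt inv_e H a (S_extension E src tgt H a V' g) x"
proof -
  let ?v = "S_extension E src tgt H a V' g"
  let ?F = "(\<lambda>e. ?v (tgt e) + sigma H a (inv_e e)) ` {e \<in> E. src e = x}"
  have fin: "finite ?F" and ne: "?F \<noteq> {}"
    using x graph_okD(1,2)[OF graph] by auto
  have "?v x \<le> Min ?F"
  proof (rule Min.boundedI[OF fin ne])
    fix z assume "z \<in> ?F"
    then obtain e where e: "e \<in> E" "src e = x" "z = ?v (tgt e) + sigma H a (inv_e e)"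
      by blast
    then show "?v x \<le> z"
      using DFE_subsol_S_extension graph_okD(4-6)[OF graph e(1)] unfolding DFE_subsol_def by force
  qed
  moreover have "Min ?F \<le> ?v x"
  proof -
    obtain y where y: "y \<in> V'" "?v x = g y + S_a E src tgt H a y x"
      using S_extension_attained x by blast
    \<comment> \<open>Split off the last arc f of any path from y to x; inv_e f is an arc leaving x.\<close>
    have "Min ?F - g y \<le> S_a E src tgt H a y x"
    proof (rule S_a_greatest)
      show "y \<in> V" "x \<in> V"
        using y(1) V'_sub x by auto
      fix xi assume xi: "path_from_to E src tgt y x xi"
      then obtain ys f where ys: "xi = ys @ [f]"
        by (metis not_path_from_to_Nil rev_exhaust)
      then have f: "f \<in> E" "tgt f = x"
        and prefix: "(ys = [] \<and> src f = y) \<or> path_from_to E src tgt y (src f) ys"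
        using xi by (auto simp: path_from_to_snoc)
      have "?v (src f) \<le> g y + sigma_path H a ys"
        using prefix
      proof
        assume "ys = [] \<and> src f = y"
        then show ?thesis
          using y(1) by (simp add: S_extension_def)
      next
        assume "path_from_to E src tgt y (src f) ys"
        then show ?thesis
          using S_extension_le[OF y(1), of "src f"] S_a_le_sigma_path by force
      qed
      moreover have "Min ?F \<le> ?v (src f) + sigma H a f"
        using fin f graph_okD(4-7)[OF graph f(1)] by (intro Min_le) (auto intro!: image_eqI[of _ _ "inv_e f"])
      ultimately show "Min ?F - g y \<le> sigma_path H a xi"
        using ys by simp
    qed
    then show ?thesis
      using y(2) by simp
  qed
  ultimately show ?thesis
    unfolding DFE_at_def by simp
qed

end

end

theorem theorem6p24:
  fixes V :: "'v set" and E :: "'e set" and src tgt :: "'e \<Rightarrow> 'v" and inv_e :: "'e \<Rightarrow> 'e"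
    and H :: "'e \<Rightarrow> real \<Rightarrow> real \<Rightarrow> real" and a :: real
    and V' :: "'v set" and g :: "'v \<Rightarrow> real"
  assumes net: "network_ok V E src tgt inv_e H"
    and a_gt: "a > crit_c E src tgt H"
    and V'_sub: "V' \<subseteq> V" and V'_ne: "V' \<noteq> {}"
    and g_comp: "\<forall>x\<in>V'. \<forall>y\<in>V'. g x - g y \<le> S_a E src tgt H a y x"
  defines "v \<equiv> (\<lambda>x. if x \<in> V' then g x
                     else Min ((\<lambda>y. g y + S_a E src tgt H a y x) ` V'))"
  shows "(\<forall>x\<in>V - V'. DFE_at E src tgt inv_e H a v x)
       \<and> (\<forall>x\<in>V'. v x = g x)
       \<and> (\<forall>w. (\<forall>x\<in>V - V'. DFE_at E src tgt inv_e H a w x) \<and> (\<forall>x\<in>V'. w x = g x)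
              \<longrightarrow> (\<forall>x\<in>V. w x = v x))
       \<and> DFE_subsol E src tgt H a v"
proof -
  have graph: "graph_ok V E src tgt inv_e" and conn: "connected_graph V E src tgt"
    using net unfolding network_ok_def by auto
  obtain u where strict: "DFE_strict_subsol E src tgt H a u"
    using strict_subsol_above_crit[OF net a_gt] .
  then have subsol: "\<exists>u. DFE_subsol E src tgt H a u"
    using DFE_strict_subsol_imp_subsol by blast
  have v: "v = S_extension E src tgt H a V' g"
    unfolding v_def S_extension_def ..
  have solves: "\<forall>x\<in>V - V'. DFE_at E src tgt inv_e H a v x"
    using DFE_at_S_extension[OF graph conn subsol V'_sub V'_ne g_comp] unfolding v by blast
  have boundary: "\<forall>x\<in>V'. v x = g x"
    unfolding v_def by simp
  have unique: "\<forall>x\<in>V. w x = v x"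
    if "\<forall>x\<in>V - V'. DFE_at E src tgt inv_e H a w x" "\<forall>x\<in>V'. w x = g x" for w
    using DFE_at_unique[OF graph strict that(1) solves] that(2) boundary by simp
  show ?thesis
    using solves boundary unique DFE_subsol_S_extension[OF graph conn subsol V'_sub V'_ne g_comp]
    unfolding v by blast
qed

end
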